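(* Let $\alpha>0$ and let $h\colon\mathbb{R}\to\left]-\infty,+\infty\right]$ be given by $h(x):=\alpha/x$ if $x>0$ and $h(x):=+\infty$ if $x\leq0$. Let $y\in\mathbb{R}$ and set $y_0:=-3\sqrt[3]{\alpha/4}\approx-1.88988\sqrt[3]{\alpha}$. Then we have the following three possibilities: (i) If $y_0<y$, then $$\operatorname{Prox}_h(y)=\frac{y}{3}+\sqrt[3]{\frac{\alpha}{2}+\Big(\frac{y}{3}\Big)^3+\sqrt{\alpha\Big(\frac{\alpha}{4}+\Big(\frac{y}{3}\Big)^3\Big)}}+\sqrt[3]{\frac{\alpha}{2}+\Big(\frac{y}{3}\Big)^3-\sqrt{\alpha\Big(\frac{\alpha}{4}+\Big(\frac{y}{3}\Big)^3\Big)}}.$$ (ii) If $y=y_0$, then $\operatorname{Prox}_h(y_0)=\sqrt[3]{\alpha}/\sqrt[3]{4}\approx0.62996\sqrt[3]{\alpha}$. (iii) If $y<y_0$, then $$\operatorname{Prox}_h(y)=\frac{y}{3}\bigg(1-2\cos\Big(\frac13\arccos\frac{(y/3)^3+\alpha/2}{-(y/3)^3}\Big)\bigg).$$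
   Context: $\operatorname{Prox}_h(y)$ denotes the proximal mapping of the convex function $h$ at $y$, i.e., the unique minimizer over $x\in\mathbb{R}$ of $h(x)+\tfrac12(x-y)^2$. For real $t$, $\sqrt[3]{t}$ denotes the unique real cube root of $t$ (also for negative $t$). $\arccos$ takes values in $[0,\pi]$. The symbols $\approx$ are only numerical approximations. *)

theory Defs
  imports Complex_Main "HOL-Library.Extended_Real"
begin

definition prox_minimizer :: "(real \<Rightarrow> ereal) \<Rightarrow> real \<Rightarrow> real \<Rightarrow> bool" where
  "prox_minimizer h y p \<longleftrightarrow>
     is_arg_min (\<lambda>x. h x + ereal ((x - y)\<^sup>2 / 2)) (\<lambda>x. True) p"

text \<open>
  As a definite description, \<open>Prox h y\<close> is meaningful only when there is exactly one
  minimizer; a statement about \<open>Prox h y\<close> should come with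
  \<open>\<exists>!p. prox_minimizer h y p\<close>.
\<close>

definition Prox :: "(real \<Rightarrow> ereal) \<Rightarrow> real \<Rightarrow> real" where
  "Prox h y = (THE p. prox_minimizer h y p)"

end

theory Submission
  imports Defs
begin

text \<open>
  On the half-line \<open>x > 0\<close>, where \<open>h\<close> is finite, the objective
  \<open>\<alpha> / x + (x - y)\<^sup>2 / 2\<close> is strictly convex, so a minimizer is the same thing as a positive
  stationary point, that is, a positive root \<open>p\<close> of the cubic \<open>p\<^sup>2 (p - y) = \<alpha>\<close>.
  The convexity is used through an exact formula for the gap between the values at \<open>x\<close> and at
  \<open>p\<close> (\<open>prox_gap\<close>); the gap is positive for \<open>x \<noteq> p\<close>, which gives optimality and
  uniqueness together (\<open>prox_reciprocal\<close>). Existence then needs no compactness argument: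
  exhibiting one positive root suffices.

  With \<open>q = y / 3\<close>, the shift \<open>p = q + z\<close> removes the quadratic term and leaves
  \<open>z ^ 3 = 3 q\<^sup>2 z + 2 (q ^ 3 + \<alpha> / 2)\<close>, whose discriminant has the sign of
  \<open>- (\<alpha> / 4 + q ^ 3)\<close>. For \<open>q ^ 3 > - \<alpha> / 4\<close> Cardano's formula gives the only real root
  (\<open>cardano_root\<close>). For \<open>q ^ 3 < - \<alpha> / 4\<close> there are three real roots, and Viete's
  substitution \<open>z = - 2 q cos \<theta>\<close> turns the cubic into the triple-angle formula; the choice
  \<open>\<theta> < \<pi> / 3\<close> selects the positive one (\<open>viete_root\<close>). On the boundary the positive root
  is \<open>- q\<close>.
\<close>

section \<open>Minimizers as positive roots of a cubic\<close>

text \<open>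
  Both summands on the right are the remainders of tangent-line approximations at \<open>p\<close>, one of
  \<open>\<alpha> / x\<close> and one of the quadratic; the linear parts cancel because \<open>p\<close> is stationary.
\<close>

lemma prox_gap:
  fixes \<alpha> x y p :: real
  assumes "x > 0" "p > 0" and root: "p\<^sup>2 * (p - y) = \<alpha>"
  shows "(\<alpha> / x + (x - y)\<^sup>2 / 2) - (\<alpha> / p + (p - y)\<^sup>2 / 2)
    = (x - p)\<^sup>2 / 2 + \<alpha> * (x - p)\<^sup>2 / (x * p\<^sup>2)"
proof -
  have "\<alpha> / x - \<alpha> / p + (p - y) * (x - p) = \<alpha> * (x - p)\<^sup>2 / (x * p\<^sup>2)"
    unfolding root[symmetric] using assms(1,2)
    by (simp add: field_simps power2_eq_square)
  moreover have "(x - y)\<^sup>2 / 2 - (p - y)\<^sup>2 / 2 = (x - p)\<^sup>2 / 2 + (p - y) * (x - p)"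
    by (simp add: field_simps power2_eq_square)
  ultimately show ?thesis by linarith
qed

lemma prox_reciprocal:
  fixes \<alpha> y p :: real and h :: "real \<Rightarrow> ereal"
  assumes "\<alpha> > 0" and h: "h = (\<lambda>x. if x > 0 then ereal (\<alpha> / x) else \<infinity>)"
    and "p > 0" and root: "p\<^sup>2 * (p - y) = \<alpha>"
  shows "\<exists>!p. prox_minimizer h y p" and "Prox h y = p"
proof -
  let ?f = "\<lambda>x. h x + ereal ((x - y)\<^sup>2 / 2)"
  have less: "?f p < ?f x" if "x \<noteq> p" for x
  proof (cases "x > 0")
    case True
    have "(x - p)\<^sup>2 / 2 + \<alpha> * (x - p)\<^sup>2 / (x * p\<^sup>2) > 0"
      using that True \<open>\<alpha> > 0\<close> \<open>p > 0\<close> by (intro add_pos_nonneg) auto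
    then have "\<alpha> / p + (p - y)\<^sup>2 / 2 < \<alpha> / x + (x - y)\<^sup>2 / 2"
      using prox_gap[OF True \<open>p > 0\<close> root] by linarith
    then show ?thesis using True \<open>p > 0\<close> by (simp add: h)
  next
    case False
    then show ?thesis using \<open>p > 0\<close> by (simp add: h)
  qed
  have iff: "prox_minimizer h y x \<longleftrightarrow> x = p" for x
    unfolding prox_minimizer_def is_arg_min_def using less by (metis less_asym)
  show "\<exists>!p. prox_minimizer h y p" using iff by simp
  show "Prox h y = p" unfolding Prox_def using iff by (intro the_equality) auto
qed

section \<open>Positive roots of the cubic\<close>

lemma depressed_cubic:
  fixes q z \<alpha> :: real
  assumes "z ^ 3 = 3 * q\<^sup>2 * z + 2 * (q ^ 3 + \<alpha> / 2)"
  shows "(q + z)\<^sup>2 * (q + z - 3 * q) = \<alpha>"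
proof -
  have "(q + z)\<^sup>2 * (q + z - 3 * q) = z ^ 3 - 3 * q\<^sup>2 * z - 2 * q ^ 3"
    by (simp add: algebra_simps power2_eq_square power3_eq_cube)
  with assms show ?thesis by simp
qed

text \<open>
  The two radicands have product \<open>q ^ 6\<close>, so their cube roots \<open>u\<close> and \<open>v\<close> satisfy
  \<open>u v = q\<^sup>2\<close>, which is what makes \<open>u + v\<close> a root of the depressed cubic. Positivity of
  \<open>q + u + v\<close> also comes from this product: \<open>(u + v)\<^sup>2 > 2 u v \<ge> q\<^sup>2\<close>.
\<close>

lemma cardano_root:
  fixes q \<alpha> :: real
  assumes "\<alpha> > 0" and disc: "\<alpha> / 4 + q ^ 3 > 0"
  defines "s \<equiv> sqrt (\<alpha> * (\<alpha> / 4 + q ^ 3))"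
  defines "u \<equiv> root 3 (\<alpha> / 2 + q ^ 3 + s)" and "v \<equiv> root 3 (\<alpha> / 2 + q ^ 3 - s)"
  shows "q + u + v > 0" and "(q + u + v)\<^sup>2 * (q + u + v - 3 * q) = \<alpha>"
proof -
  have s2: "s\<^sup>2 = \<alpha> * (\<alpha> / 4 + q ^ 3)" and "s \<ge> 0"
    using assms by (simp_all add: s_def)
  have "(\<alpha> / 2 + q ^ 3 + s) * (\<alpha> / 2 + q ^ 3 - s) = (\<alpha> / 2 + q ^ 3)\<^sup>2 - s\<^sup>2"
    by (simp add: algebra_simps power2_eq_square)
  also have "\<dots> = (q\<^sup>2) ^ 3"
    unfolding s2 by (simp add: field_simps power2_eq_square power3_eq_cube)
  finally have prod: "(\<alpha> / 2 + q ^ 3 + s) * (\<alpha> / 2 + q ^ 3 - s) = (q\<^sup>2) ^ 3" .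
  have "u * v = root 3 ((q\<^sup>2) ^ 3)"
    unfolding u_def v_def prod[symmetric] by (rule real_root_mult[symmetric])
  also have "\<dots> = q\<^sup>2" by (rule odd_real_root_power_cancel) simp
  finally have uv: "u * v = q\<^sup>2" .
  have "u ^ 3 = \<alpha> / 2 + q ^ 3 + s" and "v ^ 3 = \<alpha> / 2 + q ^ 3 - s"
    unfolding u_def v_def by (simp_all add: odd_real_root_pow)
  then have sum: "u ^ 3 + v ^ 3 = 2 * (q ^ 3 + \<alpha> / 2)" by simp
  have "(u + v) ^ 3 = 3 * (u * v) * (u + v) + (u ^ 3 + v ^ 3)"
    by (simp add: algebra_simps power2_eq_square power3_eq_cube)
  then have "(u + v) ^ 3 = 3 * q\<^sup>2 * (u + v) + 2 * (q ^ 3 + \<alpha> / 2)"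
    unfolding uv sum .
  from depressed_cubic[OF this] show "(q + u + v)\<^sup>2 * (q + u + v - 3 * q) = \<alpha>"
    by (simp add: add.assoc)
  have "\<alpha> / 2 + q ^ 3 + s > 0" using assms(1,2) \<open>s \<ge> 0\<close> by linarith
  then have "u > 0" unfolding u_def by simp
  have "v \<ge> 0" using uv \<open>u > 0\<close> by (metis zero_le_mult_iff zero_le_power2 not_less)
  have "\<bar>q\<bar>\<^sup>2 < (u + v)\<^sup>2"
  proof -
    have "(u + v)\<^sup>2 = u\<^sup>2 + v\<^sup>2 + 2 * q\<^sup>2"
      unfolding uv[symmetric] by (simp add: algebra_simps power2_eq_square)
    moreover have "u\<^sup>2 > 0" using \<open>u > 0\<close> by simp
    ultimately show ?thesis
      using zero_le_power2[of v] zero_le_power2[of q] unfolding power2_abs by linarith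
  qed
  then have "\<bar>q\<bar> < u + v"
    using \<open>u > 0\<close> \<open>v \<ge> 0\<close> by (intro power_less_imp_less_base[of "\<bar>q\<bar>" 2]) auto
  then show "q + u + v > 0" by linarith
qed

text \<open>
  Substituting \<open>z = - 2 q cos \<theta>\<close> into the depressed cubic and using
  \<open>4 cos\<^sup>3 \<theta> - 3 cos \<theta> = cos (3 \<theta>)\<close> leaves \<open>- q ^ 3 cos (3 \<theta>) = q ^ 3 + \<alpha> / 2\<close>. The
  hypotheses put the resulting cosine strictly between \<open>- 1\<close> and \<open>1\<close>; the lower
  bound forces \<open>\<theta> < \<pi> / 3\<close>, so \<open>cos \<theta> > 1 / 2\<close> and the root is positive.
\<close>

lemma viete_root:
  fixes q \<alpha> :: real
  assumes "\<alpha> > 0" and disc: "\<alpha> / 4 + q ^ 3 < 0"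
  defines "p \<equiv> q * (1 - 2 * cos (1 / 3 * arccos ((q ^ 3 + \<alpha> / 2) / (- (q ^ 3)))))"
  shows "p > 0" and "p\<^sup>2 * (p - 3 * q) = \<alpha>"
proof -
  define c where "c = (q ^ 3 + \<alpha> / 2) / (- (q ^ 3))"
  define t where "t = arccos c / 3"
  have q3: "q ^ 3 < 0" using assms by linarith
  then have "q < 0" by (metis not_less zero_le_power)
  have c: "- 1 < c" "c < 1"
    using assms q3 unfolding c_def by (simp_all add: field_simps)
  have t: "0 < t" "t < pi / 3"
    using arccos_lt_bounded[OF c] by (simp_all add: t_def)
  have "cos (pi / 3) < cos t" using t by (intro cos_monotone_0_pi) auto
  then have "cos t > 1 / 2" by (simp add: cos_60)
  have p: "p = q * (1 - 2 * cos t)" by (simp add: p_def t_def c_def)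
  show "p > 0" unfolding p using \<open>q < 0\<close> \<open>cos t > 1 / 2\<close>
    by (intro mult_neg_neg) auto
  have "4 * cos t ^ 3 - 3 * cos t = c"
    using cos_treble_cos[of t] c by (simp add: t_def)
  moreover have "- (q ^ 3) * c = q ^ 3 + \<alpha> / 2" using q3 by (simp add: c_def)
  ultimately have trig: "- (q ^ 3) * (4 * cos t ^ 3 - 3 * cos t) = q ^ 3 + \<alpha> / 2"
    by simp
  have "(- 2 * q * cos t) ^ 3
      = 3 * q\<^sup>2 * (- 2 * q * cos t) + 2 * (- (q ^ 3) * (4 * cos t ^ 3 - 3 * cos t))"
    by (simp add: algebra_simps power2_eq_square power3_eq_cube)
  then have "(- 2 * q * cos t) ^ 3 = 3 * q\<^sup>2 * (- 2 * q * cos t) + 2 * (q ^ 3 + \<alpha> / 2)"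
    unfolding trig .
  from depressed_cubic[OF this] show "p\<^sup>2 * (p - 3 * q) = \<alpha>"
    unfolding p by (simp add: algebra_simps)
qed

section \<open>The proximal mapping of the reciprocal\<close>

theorem proposition5p1:
  fixes \<alpha> y y0 :: real and h :: "real \<Rightarrow> ereal"
  assumes "\<alpha> > 0"
    and "h = (\<lambda>x. if x > 0 then ereal (\<alpha> / x) else \<infinity>)"
    and "y0 = - 3 * root 3 (\<alpha> / 4)"
  shows "(\<exists>!p. prox_minimizer h y p) \<and>
    (y0 < y \<longrightarrow>
      Prox h y = y / 3
        + root 3 (\<alpha> / 2 + (y / 3) ^ 3 + sqrt (\<alpha> * (\<alpha> / 4 + (y / 3) ^ 3)))
        + root 3 (\<alpha> / 2 + (y / 3) ^ 3 - sqrt (\<alpha> * (\<alpha> / 4 + (y / 3) ^ 3)))) \<and>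
    (y = y0 \<longrightarrow> Prox h y0 = root 3 \<alpha> / root 3 4) \<and>
    (y < y0 \<longrightarrow>
      Prox h y = y / 3 *
        (1 - 2 * cos (1 / 3 * arccos (((y / 3) ^ 3 + \<alpha> / 2) / (- ((y / 3) ^ 3))))))"
proof -
  define q where "q = y / 3"
  have y: "y = 3 * q" by (simp add: q_def)
  have y0: "y0 = 3 * root 3 (- \<alpha> / 4)" using assms(3) by (simp add: real_root_minus flip: minus_divide_left)
  \<comment> \<open>Cubing is monotone, so comparing \<open>y\<close> with \<open>y0\<close> reads off the sign of the discriminant.\<close>
  have less: "y0 < y \<longleftrightarrow> \<alpha> / 4 + q ^ 3 > 0" and greater: "y < y0 \<longleftrightarrow> \<alpha> / 4 + q ^ 3 < 0"
  proof -
    have q: "q = root 3 (q ^ 3)" by (simp add: odd_real_root_power_cancel)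
    have "y0 < y \<longleftrightarrow> root 3 (- \<alpha> / 4) < root 3 (q ^ 3)" unfolding q[symmetric] y0 y by simp
    also have "\<dots> \<longleftrightarrow> - \<alpha> / 4 < q ^ 3" by simp
    finally show "y0 < y \<longleftrightarrow> \<alpha> / 4 + q ^ 3 > 0" by auto
    have "y < y0 \<longleftrightarrow> root 3 (q ^ 3) < root 3 (- \<alpha> / 4)" unfolding q[symmetric] y0 y by simp
    also have "\<dots> \<longleftrightarrow> q ^ 3 < - \<alpha> / 4" by simp
    finally show "y < y0 \<longleftrightarrow> \<alpha> / 4 + q ^ 3 < 0" by auto
  qed
  note prox = prox_reciprocal[OF assms(1,2), of _ y]
  consider "y0 < y" | "y = y0" | "y < y0" by linarith
  then show ?thesis
  proof cases
    case 1
    from cardano_root[OF assms(1), of q] less 1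
    show ?thesis
      using prox unfolding y by (simp add: add.assoc)
  next
    case 2
    define p where "p = root 3 (\<alpha> / 4)"
    have "p > 0" using assms(1) by (simp add: p_def)
    moreover have "p\<^sup>2 * (p - y) = 4 * p ^ 3"
      using 2 assms(3) by (simp add: p_def power2_eq_square power3_eq_cube)
    then have "p\<^sup>2 * (p - y) = \<alpha>" by (simp add: p_def odd_real_root_pow)
    ultimately show ?thesis
      using prox[of p] 2 by (simp add: p_def real_root_divide)
  next
    case 3
    from viete_root[OF assms(1), of q] greater 3
    show ?thesis
      using prox unfolding y by simp
  qed
qed

end
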